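(* Let $H$ be the complexification of a separable real Hilbert space, let $n\ge 1$, and let $P^{(n)}_{\alpha,q}=\sum_{\sigma\in B(n)}\alpha^{l_1(\sigma)}q^{l_2(\sigma)}\,\sigma$ be the type B symmetrization operator on $\mathcal K_n=H^{\otimes 2n}$. If $\alpha\in[-1,1]$ and $q=\pm1$, or $q\in[-1,1]$ and $\alpha=\pm1$, then the operator $P^{(n)}_{\alpha,q}$ has a nontrivial kernel.
   Context: Notation: $\bar k=-k$, $[\pm n]=\{-n,\dots,-1,1,\dots,n\}$; $0^0=1$. The tensor factors of $\mathcal K_n=H^{\otimes 2n}$ are indexed by $[\pm n]$ in increasing order: $x_{\bar n}\otimes\cdots\otimes x_{\bar 1}\otimes x_1\otimes\cdots\otimes x_n$. The hyperoctahedral group $B(n)$ is the group of permutations $\sigma$ of $[\pm n]$ with $\sigma(-i)=-\sigma(i)$; it is the Coxeter group of type B with generators $\pi_0=(\bar 1\ 1)$ and $\pi_i=(i\ \, i{+}1)(\bar i\ \,\overline{i+1})$, $1\le i\le n-1$. It acts on $\mathcal K_n$ by $\sigma(x_{\bar n}\otimes\cdots\otimes x_n)=x_{\sigma^{-1}(\bar n)}\otimes\cdots\otimes x_{\sigma^{-1}(n)}$. For $\sigma\in B(n)$, $l_1(\sigma)$ (resp. $l_2(\sigma)$) is the number of occurrences of $\pi_0$ (resp. of all of $\pi_1,\dots,\pi_{n-1}$) in a minimal-length expression of $\sigma$ as a product of the generators; these numbers do not depend on the chosen minimal-length expression.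
   Formalization: Adds: for n=1, α must be ±1 (else 1+απ₀ is injective); and dim H≥2, or H≠0 with α=-1 or (q=-1 and n≥2), since for dim H=1 the operator is otherwise a nonzero scalar and for H=0 there is no nonzero vector. Only cases where the claim fails are excluded. *)

theory Defs
  imports "HOL-Analysis.Analysis" "HOL-Combinatorics.Permutations"
begin

text \<open>
  The complexification of a real Hilbert space \<open>'h\<close> is the type \<open>'h \<times> 'h\<close>, where \<open>(x, y)\<close> stands
  for \<open>x + \<i> y\<close>.  Its library norm and topology are those of the complex inner product below
  (see \<open>Re_cinner\<close>), which is conjugate linear in the first argument.
\<close>

definition cscale :: "complex \<Rightarrow> 'h::real_inner \<times> 'h \<Rightarrow> 'h \<times> 'h" where
  "cscale c z = (Re c *\<^sub>R fst z - Im c *\<^sub>R snd z, Re c *\<^sub>R snd z + Im c *\<^sub>R fst z)"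

definition cinner :: "'h::real_inner \<times> 'h \<Rightarrow> 'h \<times> 'h \<Rightarrow> complex" where
  "cinner z w = Complex (fst z \<bullet> fst w + snd z \<bullet> snd w) (fst z \<bullet> snd w - snd z \<bullet> fst w)"

lemma Re_cinner: "Re (cinner z w) = z \<bullet> w"
  by (simp add: cinner_def inner_prod_def)

lemma cinner_add_left: "cinner (x + y) w = cinner x w + cinner y w"
  by (simp add: cinner_def complex_eq_iff algebra_simps)

lemma cinner_add_right: "cinner w (x + y) = cinner w x + cinner w y"
  by (simp add: cinner_def complex_eq_iff algebra_simps)

lemma cinner_cscale_left: "cinner (cscale c x) w = cnj c * cinner x w"
  by (simp add: cinner_def cscale_def complex_eq_iff algebra_simps)

lemma cinner_cscale_right: "cinner w (cscale c x) = c * cinner w x"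
  by (simp add: cinner_def cscale_def complex_eq_iff algebra_simps)

lemma cinner_commute: "cinner z w = cnj (cinner w z)"
  by (simp add: cinner_def complex_eq_iff inner_commute)

lemma cinner_self: "cinner z z = complex_of_real ((norm z)\<^sup>2)"
  by (simp add: cinner_def complex_eq_iff power2_norm_eq_inner inner_prod_def inner_commute)

lemma cinner_sum_right: "cinner w (\<Sum>i\<in>A. f i) = (\<Sum>i\<in>A. cinner w (f i))"
proof (induction A rule: infinite_finite_induct)
  case (insert a A) then show ?case by (simp add: cinner_add_right)
qed (simp_all add: cinner_def complex_eq_iff)

definition corthonormal :: "('h::real_inner \<times> 'h) set \<Rightarrow> bool" where
  "corthonormal F \<longleftrightarrow> (\<forall>e\<in>F. \<forall>f\<in>F. cinner e f = (if e = f then 1 else 0))"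

lemma Bessel_cinner:
  assumes "finite F" "corthonormal F"
  shows "(\<Sum>f\<in>F. (cmod (cinner f x))\<^sup>2) \<le> (norm x)\<^sup>2"
proof -
  define s where "s = (\<Sum>f\<in>F. cscale (cinner f x) f)"
  have fs: "cinner f s = cinner f x" if "f \<in> F" for f
  proof -
    have "cinner f s = (\<Sum>g\<in>F. cinner g x * cinner f g)"
      by (simp add: s_def cinner_sum_right cinner_cscale_right)
    also have "\<dots> = (\<Sum>g\<in>F. if f = g then cinner g x else 0)"
      using assms(2) that by (intro sum.cong) (auto simp: corthonormal_def)
    finally show ?thesis using assms(1) that by simp
  qed
  have ips: "w \<bullet> s = (\<Sum>f\<in>F. (cmod (cinner f x))\<^sup>2)"
    if "\<And>f. f \<in> F \<Longrightarrow> cinner f w = cinner f x" for w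
  proof -
    have "cinner w s = (\<Sum>f\<in>F. cinner f x * cinner w f)"
      by (simp add: s_def cinner_sum_right cinner_cscale_right)
    also have "\<dots> = (\<Sum>f\<in>F. complex_of_real ((cmod (cinner f x))\<^sup>2))"
      using that by (intro sum.cong refl)
        (simp only: complex_norm_square cinner_commute[of w])
    finally have "Re (cinner w s) = (\<Sum>f\<in>F. (cmod (cinner f x))\<^sup>2)"
      by simp
    then show ?thesis by (simp add: Re_cinner)
  qed
  have "0 \<le> (x - s) \<bullet> (x - s)" by simp
  also have "\<dots> = x \<bullet> x - 2 * (x \<bullet> s) + s \<bullet> s"
    by (simp add: inner_diff_left inner_diff_right inner_commute)
  also have "\<dots> = (norm x)\<^sup>2 - (\<Sum>f\<in>F. (cmod (cinner f x))\<^sup>2)"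
    using ips[of x] ips[of s] fs by (simp add: power2_norm_eq_inner)
  finally show ?thesis by simp
qed


definition pm :: "nat \<Rightarrow> int set" where
  "pm n = {- int n..int n} - {0}"

lemma finite_pm [simp]: "finite (pm n)"
  by (simp add: pm_def)


text \<open>
  The Hilbert space tensor power indexed by \<open>pm n\<close>, realised as the space of Hilbert--Schmidt
  functionals on \<open>2n\<close>-tuples that are conjugate linear in every argument; the simple tensor
  \<open>x\<^bsub>-n\<^esub> \<otimes> \<dots> \<otimes> x\<^bsub>n\<^esub>\<close> is the functional \<open>y \<mapsto> \<Prod>\<^sub>k \<langle>y\<^sub>k, x\<^sub>k\<rangle>\<close> (Kadison and Ringrose, Fundamentals of the
  Theory of Operator Algebras I, Section 2.6).  A tuple is a function on \<open>int\<close> of which only the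
  values on \<open>pm n\<close> matter.  The Hilbert--Schmidt norm is the supremum over finite orthonormal sets of
  the finite sums in \<open>tensor_power\<close>; this is the usual sum over an orthonormal basis, and its
  finiteness already implies boundedness of the functional.
\<close>

definition simple_tensor :: "nat \<Rightarrow> (int \<Rightarrow> 'h::real_inner \<times> 'h) \<Rightarrow> (int \<Rightarrow> 'h \<times> 'h) \<Rightarrow> complex" where
  "simple_tensor n x = (\<lambda>y. \<Prod>k\<in>pm n. cinner (y k) (x k))"

definition conj_multilinear :: "nat \<Rightarrow> ((int \<Rightarrow> 'h::real_inner \<times> 'h) \<Rightarrow> complex) \<Rightarrow> bool" where
  "conj_multilinear n T \<longleftrightarrow>
     (\<forall>x y. (\<forall>k\<in>pm n. x k = y k) \<longrightarrow> T x = T y) \<and>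
     (\<forall>k\<in>pm n. \<forall>x u v. T (x(k := u + v)) = T (x(k := u)) + T (x(k := v))) \<and>
     (\<forall>k\<in>pm n. \<forall>x c u. T (x(k := cscale c u)) = cnj c * T (x(k := u)))"

definition tensor_power :: "nat \<Rightarrow> ((int \<Rightarrow> 'h::real_inner \<times> 'h) \<Rightarrow> complex) set" where
  "tensor_power n = {T. conj_multilinear n T \<and>
     (\<exists>C. \<forall>F. finite F \<and> corthonormal F \<longrightarrow>
        (\<Sum>e\<in>PiE (pm n) (\<lambda>_. F). (cmod (T e))\<^sup>2) \<le> C)}"

lemma simple_tensor_in_tensor_power: "simple_tensor n x \<in> tensor_power n"
proof -
  have upd: "simple_tensor n x (y(k := u)) =
      cinner u (x k) * (\<Prod>j\<in>pm n - {k}. cinner (y j) (x j))" if "k \<in> pm n" for y k u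
    using that by (simp add: simple_tensor_def prod.remove[of "pm n" k])
  have "conj_multilinear n (simple_tensor n x)"
    unfolding conj_multilinear_def
    by (auto simp: upd cinner_add_left cinner_cscale_left algebra_simps)
       (auto simp: simple_tensor_def)
  moreover have "(\<Sum>e\<in>PiE (pm n) (\<lambda>_. F). (cmod (simple_tensor n x e))\<^sup>2) \<le> (\<Prod>k\<in>pm n. (norm (x k))\<^sup>2)"
    if "finite F" "corthonormal F" for F
  proof -
    have "(\<Sum>e\<in>PiE (pm n) (\<lambda>_. F). (cmod (simple_tensor n x e))\<^sup>2) =
        (\<Sum>e\<in>PiE (pm n) (\<lambda>_. F). \<Prod>k\<in>pm n. (cmod (cinner (e k) (x k)))\<^sup>2)"
      by (simp add: simple_tensor_def prod_norm[symmetric] prod_power_distrib)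
    also have "\<dots> = (\<Prod>k\<in>pm n. \<Sum>f\<in>F. (cmod (cinner f (x k)))\<^sup>2)"
      using that by (simp add: prod_sum_PiE)
    also have "\<dots> \<le> (\<Prod>k\<in>pm n. (norm (x k))\<^sup>2)"
      using Bessel_cinner[OF that] by (intro prod_mono) (auto intro: sum_nonneg)
    finally show ?thesis .
  qed
  ultimately show ?thesis unfolding tensor_power_def by blast
qed


definition type_B :: "nat \<Rightarrow> (int \<Rightarrow> int) set" where
  "type_B n = {\<sigma>. \<sigma> permutes pm n \<and> (\<forall>i\<in>pm n. \<sigma> (- i) = - \<sigma> i)}"

definition gen_B :: "nat \<Rightarrow> int \<Rightarrow> int" where
  "gen_B i = (if i = 0 then Transposition.transpose (-1) 1
     else Transposition.transpose (int i) (int i + 1) \<circ> Transposition.transpose (- int i) (- (int i + 1)))"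

definition word_prod :: "nat list \<Rightarrow> int \<Rightarrow> int" where
  "word_prod w = foldr (\<lambda>i \<sigma>. gen_B i \<circ> \<sigma>) w id"

definition expression_of :: "nat \<Rightarrow> (int \<Rightarrow> int) \<Rightarrow> nat list \<Rightarrow> bool" where
  "expression_of n \<sigma> w \<longleftrightarrow> set w \<subseteq> {..<n} \<and> word_prod w = \<sigma>"

definition minimal_expression_of :: "nat \<Rightarrow> (int \<Rightarrow> int) \<Rightarrow> nat list \<Rightarrow> bool" where
  "minimal_expression_of n \<sigma> w \<longleftrightarrow>
     expression_of n \<sigma> w \<and> (\<forall>v. expression_of n \<sigma> v \<longrightarrow> length w \<le> length v)"

text \<open>
  The two counts are the same for all minimal expressions of an element of \<open>type_B n\<close>, so the choice
  made by \<open>SOME\<close> is immaterial.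
\<close>

definition l1 :: "nat \<Rightarrow> (int \<Rightarrow> int) \<Rightarrow> nat" where
  "l1 n \<sigma> = length (filter (\<lambda>i. i = 0) (SOME w. minimal_expression_of n \<sigma> w))"

definition l2 :: "nat \<Rightarrow> (int \<Rightarrow> int) \<Rightarrow> nat" where
  "l2 n \<sigma> = length (filter (\<lambda>i. i \<noteq> 0) (SOME w. minimal_expression_of n \<sigma> w))"


definition perm_act ::
    "(int \<Rightarrow> int) \<Rightarrow> ((int \<Rightarrow> 'h::real_inner \<times> 'h) \<Rightarrow> complex) \<Rightarrow> (int \<Rightarrow> 'h \<times> 'h) \<Rightarrow> complex" where
  "perm_act \<sigma> T = (\<lambda>y. T (y \<circ> \<sigma>))"

text \<open>On simple tensors this is the action that moves the factor at place \<open>k\<close> to place \<open>\<sigma> k\<close>:\<close>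

lemma perm_act_simple_tensor:
  assumes "\<sigma> permutes pm n"
  shows "perm_act \<sigma> (simple_tensor n x) = simple_tensor n (x \<circ> inv \<sigma>)"
proof
  fix y
  have "simple_tensor n (x \<circ> inv \<sigma>) y = (\<Prod>k\<in>pm n. cinner (y (\<sigma> k)) (x (inv \<sigma> (\<sigma> k))))"
    unfolding simple_tensor_def
    using prod.permute[OF assms, of "\<lambda>k. cinner (y k) ((x \<circ> inv \<sigma>) k)"] by (simp add: o_def)
  then show "perm_act \<sigma> (simple_tensor n x) y = simple_tensor n (x \<circ> inv \<sigma>) y"
    by (simp add: perm_act_def simple_tensor_def permutes_inverses(2)[OF assms])
qed

lemma perm_act_in_tensor_power:
  assumes p: "\<sigma> permutes pm n" and T: "T \<in> tensor_power n"
  shows "perm_act \<sigma> T \<in> tensor_power n"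
proof -
  have cm: "conj_multilinear n T" using T by (simp add: tensor_power_def)
  have dep: "T x = T y" if "\<forall>k\<in>pm n. x k = y k" for x y
    using cm that unfolding conj_multilinear_def by blast
  have upd: "(y(k := u)) \<circ> \<sigma> = (y \<circ> \<sigma>)(inv \<sigma> k := u)" for y :: "int \<Rightarrow> 'a \<times> 'a" and k u
    using permutes_inverses[OF p] by (auto simp: fun_eq_iff)
  have in_pm: "inv \<sigma> k \<in> pm n" if "k \<in> pm n" for k
    using permutes_in_image[OF permutes_inv[OF p]] that by simp
  have "conj_multilinear n (perm_act \<sigma> T)"
    unfolding conj_multilinear_def perm_act_def upd
    using cm in_pm permutes_in_image[OF p] unfolding conj_multilinear_def
    by (auto intro!: dep)
  moreover obtain C where C: "\<And>F. finite F \<Longrightarrow> corthonormal F \<Longrightarrow>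
        (\<Sum>e\<in>PiE (pm n) (\<lambda>_. F). (cmod (T e))\<^sup>2) \<le> C"
    using T unfolding tensor_power_def by blast
  have "(\<Sum>e\<in>PiE (pm n) (\<lambda>_. F). (cmod (perm_act \<sigma> T e))\<^sup>2) \<le> C"
    if F: "finite F" "corthonormal F" for F
  proof -
    have "(\<Sum>e\<in>PiE (pm n) (\<lambda>_. F). (cmod (perm_act \<sigma> T e))\<^sup>2) =
          (\<Sum>e\<in>PiE (pm n) (\<lambda>_. F). (cmod (T e))\<^sup>2)"
    proof (rule sum.reindex_bij_witness[where j = "\<lambda>e. e \<circ> \<sigma>" and i = "\<lambda>e. e \<circ> inv \<sigma>"])
      fix e assume e: "e \<in> PiE (pm n) (\<lambda>_. F)"
      show "(e \<circ> \<sigma>) \<circ> inv \<sigma> = e" "(e \<circ> inv \<sigma>) \<circ> \<sigma> = e"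
        using permutes_inverses[OF p] by (auto simp: fun_eq_iff)
      show "e \<circ> \<sigma> \<in> PiE (pm n) (\<lambda>_. F)" "e \<circ> inv \<sigma> \<in> PiE (pm n) (\<lambda>_. F)"
        using e permutes_in_image[OF p] permutes_in_image[OF permutes_inv[OF p]]
        by (auto simp: PiE_iff extensional_def)
    qed (simp add: perm_act_def)
    then show ?thesis using C[OF F] by simp
  qed
  ultimately show ?thesis unfolding tensor_power_def by blast
qed

definition sym_B ::
    "nat \<Rightarrow> real \<Rightarrow> real \<Rightarrow> ((int \<Rightarrow> 'h::real_inner \<times> 'h) \<Rightarrow> complex) \<Rightarrow> (int \<Rightarrow> 'h \<times> 'h) \<Rightarrow> complex" where
  "sym_B n \<alpha> q T =
     (\<lambda>y. \<Sum>\<sigma>\<in>type_B n. complex_of_real (\<alpha> ^ l1 n \<sigma> * q ^ l2 n \<sigma>) * perm_act \<sigma> T y)"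

text \<open>
  Degenerate cases.  \<open>sym_B 1 \<alpha> q\<close> is \<open>1 + \<alpha> \<pi>\<^sub>0\<close> with \<open>\<pi>\<^sub>0\<close> the flip, which is injective on a nonzero
  space when \<open>\<bar>\<alpha>\<bar> < 1\<close>, whatever \<open>q\<close> is.  If \<open>'h\<close> is one-dimensional, every permutation acts as the identity and
  \<open>sym_B n \<alpha> q\<close> is multiplication by the Poincare polynomial
  \<open>\<Prod>i<n. (1 + \<alpha> q\<^sup>i) (1 + q + \<dots> + q\<^sup>i)\<close>; on the parameter range considered here this vanishes only
  for \<open>\<alpha> = -1\<close>, and for \<open>q = -1\<close> with \<open>n \<ge> 2\<close>.
\<close>

end

theory Submission
  imports Defs
begin

text \<open>
  If \<open>\<alpha> = \<plusminus>1\<close>, right multiplication by \<open>\<pi>\<^sub>0\<close> multiplies the weight \<open>\<alpha>\<^bsup>l\<^sub>1\<^esup> q\<^bsup>l\<^sub>2\<^esup>\<close> by \<open>\<alpha>\<close>, so the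
  symmetrization of a tensor with \<open>\<pi>\<^sub>0 T = -\<alpha> T\<close> equals its own negative.  For \<open>q = \<plusminus>1\<close> and \<open>n \<ge> 2\<close> the
  same argument works with \<open>\<pi>\<^sub>1\<close> and \<open>q\<close>.  Such a tensor is \<open>x \<otimes> \<dots> \<otimes> x\<close> when the sign allows
  it, and otherwise the antisymmetrization of a simple tensor in two orthogonal vectors.  The weights
  are controlled by the formulas \<open>l\<^sub>1 \<sigma> = #{i > 0. \<sigma> i < 0}\<close> and
  \<open>l\<^sub>2 \<sigma> = #{(a, b). 0 < \<bar>a\<bar> < b \<and> \<sigma> a > \<sigma> b}\<close>: each generator changes exactly one of these counts, and
  that one by one.
\<close>

section \<open>The generators and the group \<open>type_B n\<close>\<close>

lemma gen_B_0: "gen_B 0 k = (if k = 1 then -1 else if k = -1 then 1 else k)"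
  by (auto simp: gen_B_def Transposition.transpose_def)

lemma gen_B_pos:
  assumes "i > 0"
  shows "gen_B i k = (if k = int i then int i + 1 else if k = int i + 1 then int i
           else if k = - int i then - int i - 1 else if k = - int i - 1 then - int i else k)"
  using assms by (auto simp: gen_B_def Transposition.transpose_def)

lemma gen_B_gen_B [simp]: "gen_B i (gen_B i k) = k"
  by (cases "i = 0") (auto simp: gen_B_0 gen_B_pos)

lemma gen_B_comp_self [simp]: "gen_B i \<circ> gen_B i = id"
  by (simp add: fun_eq_iff)

lemma gen_B_minus: "gen_B i (- k) = - gen_B i k"
  by (cases "i = 0") (auto simp: gen_B_0 gen_B_pos)

lemma gen_B_in_pm: "i < n \<Longrightarrow> k \<in> pm n \<Longrightarrow> gen_B i k \<in> pm n"
  by (cases "i = 0") (auto simp: gen_B_0 gen_B_pos pm_def)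

lemma gen_B_notin_pm: "i < n \<Longrightarrow> k \<notin> pm n \<Longrightarrow> gen_B i k = k"
  by (cases "i = 0") (auto simp: gen_B_0 gen_B_pos pm_def)

lemma uminus_in_pm [simp]: "- k \<in> pm n \<longleftrightarrow> k \<in> pm n"
  by (auto simp: pm_def)

lemma gen_B_permutes: "i < n \<Longrightarrow> gen_B i permutes pm n"
  unfolding permutes_def by (metis gen_B_gen_B gen_B_notin_pm)

lemma gen_B_type_B: "i < n \<Longrightarrow> gen_B i \<in> type_B n"
  by (simp add: type_B_def gen_B_permutes gen_B_minus)

lemma type_B_comp: "\<sigma> \<in> type_B n \<Longrightarrow> \<tau> \<in> type_B n \<Longrightarrow> \<sigma> \<circ> \<tau> \<in> type_B n"
  by (auto simp: type_B_def permutes_compose permutes_in_image)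

lemma type_B_id: "id \<in> type_B n"
  by (simp add: type_B_def permutes_id)

lemma type_B_minus: "\<sigma> \<in> type_B n \<Longrightarrow> k \<in> pm n \<Longrightarrow> \<sigma> (- k) = - \<sigma> k"
  by (simp add: type_B_def)

lemma type_B_in_pm: "\<sigma> \<in> type_B n \<Longrightarrow> k \<in> pm n \<Longrightarrow> \<sigma> k \<in> pm n"
  by (simp add: type_B_def permutes_in_image)

lemma type_B_inj: "\<sigma> \<in> type_B n \<Longrightarrow> \<sigma> a = \<sigma> b \<longleftrightarrow> a = b"
  by (auto simp: type_B_def dest: permutes_inj injD)

lemma word_prod_Nil: "word_prod [] = id"
  by (simp add: word_prod_def)

lemma word_prod_snoc: "word_prod (w @ [i]) = word_prod w \<circ> gen_B i"
  unfolding word_prod_def by (induction w) (auto simp: o_assoc)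

lemma word_prod_type_B: "set w \<subseteq> {..<n} \<Longrightarrow> word_prod w \<in> type_B n"
proof (induction w rule: rev_induct)
  case Nil
  show ?case by (simp only: word_prod_Nil type_B_id)
next
  case (snoc i w)
  then show ?case unfolding word_prod_snoc by (intro type_B_comp gen_B_type_B) auto
qed

section \<open>Sign and inversion counts, and their change under a generator\<close>

definition neg_count :: "nat \<Rightarrow> (int \<Rightarrow> int) \<Rightarrow> nat" where
  "neg_count n \<sigma> = card {k \<in> {1..int n}. \<sigma> k < 0}"

text \<open>With \<open>e_(-c) = - e_c\<close>, the pairs index the positive long roots
  \<open>e_b - e_a\<close> of type B. The short roots \<open>e_b\<close> belong to
  \<open>neg_count\<close>.\<close>

definition inv_pairs :: "nat \<Rightarrow> (int \<times> int) set" where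
  "inv_pairs n = {(a, b). a \<in> pm n \<and> b \<in> {1..int n} \<and> \<bar>a\<bar> < b}"

definition inv_count :: "nat \<Rightarrow> (int \<Rightarrow> int) \<Rightarrow> nat" where
  "inv_count n \<sigma> = card {(a, b) \<in> inv_pairs n. \<sigma> b < \<sigma> a}"

lemma finite_inv_pairs: "finite (inv_pairs n)"
  by (rule finite_subset[of _ "pm n \<times> {1..int n}"]) (auto simp: inv_pairs_def)

text \<open>Among positive arguments only 1 is moved, and its value changes sign because \<sigma> is
  odd. The change by one is written with an indicator on each side to avoid subtraction of
  naturals.\<close>

lemma neg_count_gen_B_0:
  assumes "\<sigma> \<in> type_B n" "n > 0"
  shows "neg_count n (\<sigma> \<circ> gen_B 0) + of_bool (\<sigma> 1 < 0) = neg_count n \<sigma> + of_bool (\<sigma> 1 > 0)"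
proof -
  define A where "A = {k \<in> {2..int n}. \<sigma> k < 0}"
  have A: "finite A" "1 \<notin> A"
    by (auto simp: A_def intro: finite_subset[of _ "{2..int n}"])
  have pm: "1 \<in> pm n" using assms by (auto simp: pm_def)
  have m: "\<sigma> (-1) = - \<sigma> 1" using type_B_minus[OF assms(1) pm] by simp
  have "\<sigma> 1 \<noteq> 0" using type_B_in_pm[OF assms(1) pm] by (auto simp: pm_def)
  have "{k \<in> {1..int n}. \<sigma> k < 0} = (if \<sigma> 1 < 0 then insert 1 A else A)"
    using assms(2) by (auto simp: A_def) (smt (verit))+
  moreover have "{k \<in> {1..int n}. (\<sigma> \<circ> gen_B 0) k < 0} = (if \<sigma> 1 > 0 then insert 1 A else A)"
    using assms(2) m by (auto simp: A_def gen_B_0 split: if_splits)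
  ultimately show ?thesis using A \<open>\<sigma> 1 \<noteq> 0\<close> by (simp add: neg_count_def)
qed

text \<open>Applying \<open>gen_B 0\<close> to the first coordinate matches the inverted pairs. The
  second coordinate is fixed, since \<open>0 < \<bar>a\<bar> < b\<close> forces
  \<open>b \<ge> 2\<close>.\<close>

lemma inv_count_gen_B_0:
  assumes "n > 0"
  shows "inv_count n (\<sigma> \<circ> gen_B 0) = inv_count n \<sigma>"
  unfolding inv_count_def
proof (rule bij_betw_same_card, rule bij_betw_byWitness)
  let ?f = "\<lambda>(a, b). (gen_B 0 a, b :: int)"
  let ?S = "\<lambda>\<sigma>. {(a, b) \<in> inv_pairs n. \<sigma> b < (\<sigma> a :: int)}"
  have "\<bar>gen_B 0 a\<bar> = \<bar>a\<bar>" for a by (simp add: gen_B_0)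
  moreover have "gen_B 0 b = b" if "(a, b) \<in> inv_pairs n" for a b
    using that by (auto simp: inv_pairs_def gen_B_0 pm_def)
  ultimately show "?f ` ?S (\<sigma> \<circ> gen_B 0) \<subseteq> ?S \<sigma>" "?f ` ?S \<sigma> \<subseteq> ?S (\<sigma> \<circ> gen_B 0)"
    using gen_B_in_pm[OF assms] by (auto simp: inv_pairs_def)
qed auto

lemma neg_count_gen_B_pos:
  assumes "0 < i" "i < n"
  shows "neg_count n (\<sigma> \<circ> gen_B i) = neg_count n \<sigma>"
  unfolding neg_count_def
proof (rule bij_betw_same_card, rule bij_betw_byWitness)
  have "gen_B i k \<in> {1..int n}" if "k \<in> {1..int n}" for k
    using that assms by (auto simp: gen_B_pos)
  then show "gen_B i ` {k \<in> {1..int n}. (\<sigma> \<circ> gen_B i) k < 0} \<subseteq> {k \<in> {1..int n}. \<sigma> k < 0}"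
    "gen_B i ` {k \<in> {1..int n}. \<sigma> k < 0} \<subseteq> {k \<in> {1..int n}. (\<sigma> \<circ> gen_B i) k < 0}"
    by auto
qed auto

text \<open>Only the pair \<open>(i, i+1)\<close> changes its status. On the remaining pairs an
  involution carries the inversions of one map to those of the other.\<close>

lemma inv_count_gen_B_pos:
  assumes \<sigma>: "\<sigma> \<in> type_B n" and i: "0 < i" "i < n"
  shows "inv_count n (\<sigma> \<circ> gen_B i) + of_bool (\<sigma> (int i) > \<sigma> (int i + 1)) =
         inv_count n \<sigma> + of_bool (\<sigma> (int i) < \<sigma> (int i + 1))"
proof -
  let ?p = "(int i, int i + 1)"
  define S where "S \<tau> = {(a, b) \<in> inv_pairs n - {?p}. \<tau> b < \<tau> a}" for \<tau> :: "int \<Rightarrow> int"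
  have split: "inv_count n \<tau> = card (S \<tau>) + of_bool (\<tau> (int i) > \<tau> (int i + 1))" for \<tau>
  proof -
    have fin: "finite (S \<tau>)"
      by (rule finite_subset[OF _ finite_inv_pairs[of n]]) (auto simp: S_def)
    have p: "?p \<in> inv_pairs n" using i by (auto simp: inv_pairs_def pm_def)
    then have "{(a, b) \<in> inv_pairs n. \<tau> b < \<tau> a} =
        (if \<tau> (int i) > \<tau> (int i + 1) then insert ?p (S \<tau>) else S \<tau>)"
      by (auto simp: S_def)
    moreover have "?p \<notin> S \<tau>" by (simp add: S_def)
    ultimately show ?thesis using fin by (simp add: inv_count_def)
  qed
  \<comment> \<open>\<open>\<pi>\<^sub>i\<close> maps \<open>(-i, i+1)\<close> to \<open>(-(i+1), i)\<close>, which is not in \<open>inv_pairs n\<close> but is inverted by \<open>\<sigma>\<close> iff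
      \<open>(-i, i+1)\<close> is.\<close>
  define f where "f = (\<lambda>(a, b). if (a, b) = (- int i, int i + 1) then (a, b) else (gen_B i a, gen_B i b))"
  have m: "\<sigma> (- int i) = - \<sigma> (int i)" "\<sigma> (- int i - 1) = - \<sigma> (int i + 1)"
    using type_B_minus[OF \<sigma>, of "int i"] type_B_minus[OF \<sigma>, of "int i + 1"] i
    by (auto simp: pm_def)
  have g: "gen_B i (int i) = int i + 1" "gen_B i (int i + 1) = int i"
    "gen_B i (- int i) = - int i - 1" "gen_B i (- int i - 1) = - int i"
    using i by (auto simp: gen_B_pos)
  have fD: "f p \<in> inv_pairs n - {?p}" if "p \<in> inv_pairs n - {?p}" for p
    using that i by (cases p) (auto simp: f_def inv_pairs_def pm_def gen_B_pos split: if_splits)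
  have ff: "f (f p) = p" if "p \<in> inv_pairs n - {?p}" for p
    using that i by (cases p) (auto simp: f_def inv_pairs_def pm_def gen_B_pos split: if_splits)
  have inv: "(case f p of (a, b) \<Rightarrow> \<sigma> b < \<sigma> a) \<longleftrightarrow>
      (case p of (a, b) \<Rightarrow> (\<sigma> \<circ> gen_B i) b < (\<sigma> \<circ> gen_B i) a)" for p
    using m g by (cases p) (auto simp: f_def)
  have "card (S (\<sigma> \<circ> gen_B i)) = card (S \<sigma>)"
  proof (rule bij_betw_same_card, rule bij_betw_byWitness)
    define D where "D = inv_pairs n - {?p}"
    have S: "p \<in> S \<tau> \<longleftrightarrow> p \<in> D \<and> (case p of (a, b) \<Rightarrow> \<tau> b < \<tau> a)" for p \<tau>
      by (auto simp: S_def D_def)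
    note fD = fD[folded D_def] and ff = ff[folded D_def]
    have "f p \<in> S \<sigma>" if "p \<in> S (\<sigma> \<circ> gen_B i)" for p
      using that fD[of p] by (simp only: S inv)
    then show "f ` S (\<sigma> \<circ> gen_B i) \<subseteq> S \<sigma>" by (rule image_subsetI)
    have "f p \<in> S (\<sigma> \<circ> gen_B i)" if "p \<in> S \<sigma>" for p
    proof -
      have p: "p \<in> D" "case p of (a, b) \<Rightarrow> \<sigma> b < \<sigma> a"
        using that by (simp_all only: S)
      show ?thesis unfolding S inv[symmetric] ff[OF p(1)] using fD[OF p(1)] p(2) by (rule conjI)
    qed
    then show "f ` S \<sigma> \<subseteq> S (\<sigma> \<circ> gen_B i)" by (rule image_subsetI)
    have "p \<in> D" if "p \<in> S \<tau>" for p \<tau>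
      using that by (simp only: S)
    then show "\<forall>p\<in>S (\<sigma> \<circ> gen_B i). f (f p) = p" "\<forall>p\<in>S \<sigma>. f (f p) = p"
      using ff by metis+
  qed
  then show ?thesis
    using split[of \<sigma>] split[of "\<sigma> \<circ> gen_B i"] g by simp
qed

section \<open>The counts as letter numbers of minimal expressions\<close>

lemma counts_id: "neg_count n id = 0" "inv_count n id = 0"
proof -
  have "{k \<in> {1..int n}. id k < 0} = {}" "{(a, b) \<in> inv_pairs n. id b < id a} = {}"
    by (auto simp: inv_pairs_def)
  then show "neg_count n id = 0" "inv_count n id = 0"
    unfolding neg_count_def inv_count_def by (simp_all only: card.empty)
qed

text \<open>Appending a letter raises only the count of its own kind, and by at most one. Hence the
  bound holds for each kind of letter separately, not just for the total length.\<close>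

lemma counts_le:
  "set w \<subseteq> {..<n} \<Longrightarrow> neg_count n (word_prod w) \<le> length (filter (\<lambda>i. i = 0) w) \<and>
     inv_count n (word_prod w) \<le> length (filter (\<lambda>i. i \<noteq> 0) w)"
proof (induction w rule: rev_induct)
  case Nil
  show ?case by (simp only: word_prod_Nil counts_id) simp
next
  case (snoc i w)
  have w: "word_prod w \<in> type_B n" using snoc.prems by (simp add: word_prod_type_B)
  show ?case
  proof (cases "i = 0")
    case True
    then have "neg_count n (word_prod w \<circ> gen_B i) \<le> neg_count n (word_prod w) + 1"
      using neg_count_gen_B_0[OF w] snoc.prems by (auto simp: of_bool_def split: if_splits)
    then show ?thesis
      unfolding word_prod_snoc using snoc True inv_count_gen_B_0[of n] by (simp del: comp_apply)
  next
    case False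
    then have "inv_count n (word_prod w \<circ> gen_B i) \<le> inv_count n (word_prod w) + 1"
      using inv_count_gen_B_pos[OF w, of i] snoc.prems by (auto simp: of_bool_def split: if_splits)
    then show ?thesis
      unfolding word_prod_snoc using snoc False neg_count_gen_B_pos[of i n] by (simp del: comp_apply)
  qed
qed

text \<open>A strictly increasing integer sequence of length n that starts at 1 or above and ends at
  n or below must be 1, ..., n. Oddness settles the negative arguments.\<close>

lemma type_B_no_descent:
  assumes \<sigma>: "\<sigma> \<in> type_B n" and "n > 0 \<Longrightarrow> \<sigma> 1 > 0"
    and asc: "\<And>i. 0 < i \<Longrightarrow> i < n \<Longrightarrow> \<sigma> (int i) < \<sigma> (int i + 1)"
  shows "\<sigma> = id"
proof -
  have ge: "\<sigma> (int k) \<ge> int k" if "1 \<le> k" "k \<le> n" for k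
    using that
  proof (induction k rule: dec_induct)
    case base
    then show ?case using assms(2) by auto
  next
    case (step k)
    then show ?case using asc[of k] by (auto simp: add.commute)
  qed
  \<comment> \<open>Downward induction from n, where the bound holds because \<sigma> preserves
    \<open>pm n\<close>.\<close>
  have le: "\<sigma> (int k) \<le> int k" if "1 \<le> k" "k \<le> n" for k
    using that(2,1)
  proof (induction k rule: inc_induct)
    case base
    then have "int n \<in> pm n" by (simp add: pm_def)
    from type_B_in_pm[OF \<sigma> this] show ?case by (simp add: pm_def)
  next
    case (step k)
    then show ?case using asc[of k] by (auto simp: add.commute)
  qed
  have pos: "\<sigma> k = k" if "1 \<le> k" "k \<le> int n" for k
    using that ge[of "nat k"] le[of "nat k"] by (simp add: le_nat_iff nat_le_iff)
  show ?thesis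
  proof
    fix k
    consider "k \<notin> pm n" | "1 \<le> k" "k \<le> int n" | "1 \<le> - k" "- k \<le> int n" "k \<in> pm n"
      by (fastforce simp: pm_def)
    then show "\<sigma> k = id k"
    proof cases
      case 1
      then show ?thesis using \<sigma> by (auto simp: type_B_def permutes_def)
    next
      case 3
      then show ?thesis using pos[of "- k"] type_B_minus[OF \<sigma>, of k] by simp
    qed (simp add: pos)
  qed
qed

text \<open>Sorting by descents: a non-identity element has a descent, and composing with that
  generator on the right lowers exactly one of the counts by one. The removed generators, read
  backwards, form the word.\<close>

lemma reduced_word_exists:
  assumes "\<sigma> \<in> type_B n"
  shows "\<exists>w. expression_of n \<sigma> w \<and> length (filter (\<lambda>i. i = 0) w) = neg_count n \<sigma> \<and>
           length (filter (\<lambda>i. i \<noteq> 0) w) = inv_count n \<sigma>"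
  using assms
proof (induction "neg_count n \<sigma> + inv_count n \<sigma>" arbitrary: \<sigma> rule: less_induct)
  case less
  note \<sigma> = less.prems
  show ?case
  proof (cases "\<sigma> = id")
    case True
    then have "expression_of n \<sigma> []" by (simp add: expression_of_def word_prod_def)
    then show ?thesis using True counts_id by (intro exI[of _ "[]"]) simp
  next
    case False
    then have "(n > 0 \<and> \<not> \<sigma> 1 > 0) \<or> (\<exists>i. 0 < i \<and> i < n \<and> \<not> \<sigma> (int i) < \<sigma> (int i + 1))"
      using type_B_no_descent[OF \<sigma>] by blast
    then obtain i where i: "i < n" and c:
      "neg_count n \<sigma> = neg_count n (\<sigma> \<circ> gen_B i) + of_bool (i = 0)"
      "inv_count n \<sigma> = inv_count n (\<sigma> \<circ> gen_B i) + of_bool (i \<noteq> 0)"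
    proof (elim disjE exE conjE)
      assume *: "n > 0" "\<not> \<sigma> 1 > 0"
      then have "\<sigma> 1 < 0" using type_B_in_pm[OF \<sigma>, of 1] by (auto simp: pm_def)
      then show thesis
        using that[of 0] * neg_count_gen_B_0[OF \<sigma>] inv_count_gen_B_0[of n \<sigma>] by simp
    next
      fix i assume *: "0 < i" "i < n" "\<not> \<sigma> (int i) < \<sigma> (int i + 1)"
      then have "\<sigma> (int i + 1) < \<sigma> (int i)"
        using type_B_inj[OF \<sigma>, of "int i" "int i + 1"] by auto
      then show thesis
        using that[of i] * inv_count_gen_B_pos[OF \<sigma>, of i] neg_count_gen_B_pos[of i n \<sigma>] by simp
    qed
    have "\<sigma> \<circ> gen_B i \<in> type_B n" using \<sigma> i by (simp add: type_B_comp gen_B_type_B)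
    moreover have "neg_count n (\<sigma> \<circ> gen_B i) + inv_count n (\<sigma> \<circ> gen_B i) <
        neg_count n \<sigma> + inv_count n \<sigma>"
      using c by (cases "i = 0") simp_all
    ultimately obtain w where w: "expression_of n (\<sigma> \<circ> gen_B i) w"
      "length (filter (\<lambda>i. i = 0) w) = neg_count n (\<sigma> \<circ> gen_B i)"
      "length (filter (\<lambda>i. i \<noteq> 0) w) = inv_count n (\<sigma> \<circ> gen_B i)"
      using less.hyps by blast
    have "expression_of n \<sigma> (w @ [i])"
      using w(1) i by (simp add: expression_of_def word_prod_snoc comp_assoc)
    then show ?thesis using w c by (intro exI[of _ "w @ [i]"]) simp
  qed
qed

text \<open>A word that attains both lower bounds is minimal. This also fixes the letter numbers of
  every other minimal word, so the choice made by \<open>SOME\<close> does not matter.\<close>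

lemma l1_l2_eq_counts:
  assumes "\<sigma> \<in> type_B n"
  shows "l1 n \<sigma> = neg_count n \<sigma>" "l2 n \<sigma> = inv_count n \<sigma>"
proof -
  have len: "length w = length (filter (\<lambda>i. i = 0) w) + length (filter (\<lambda>i. i \<noteq> 0) w)"
    for w :: "nat list"
    using sum_length_filter_compl[of "\<lambda>i. i = 0" w] by simp
  have lower: "neg_count n \<sigma> \<le> length (filter (\<lambda>i. i = 0) v)"
    "inv_count n \<sigma> \<le> length (filter (\<lambda>i. i \<noteq> 0) v)" if "expression_of n \<sigma> v" for v
    using that counts_le[of v n] by (auto simp: expression_of_def)
  obtain w where w: "expression_of n \<sigma> w" "length (filter (\<lambda>i. i = 0) w) = neg_count n \<sigma>"
    "length (filter (\<lambda>i. i \<noteq> 0) w) = inv_count n \<sigma>"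
    using reduced_word_exists[OF assms] by blast
  have "length w \<le> length v" if "expression_of n \<sigma> v" for v
    using lower[OF that] w len[of w] len[of v] by linarith
  then have "minimal_expression_of n \<sigma> w"
    using w by (simp add: minimal_expression_of_def)
  moreover define v where "v = (SOME w. minimal_expression_of n \<sigma> w)"
  ultimately have "minimal_expression_of n \<sigma> v"
    by (metis someI)
  then have v: "expression_of n \<sigma> v" "length v \<le> length w"
    using w by (auto simp: minimal_expression_of_def)
  \<comment> \<open>\<open>v\<close> is no longer than the sum of the two lower bounds, so it can
    exceed neither of them.\<close>
  show "l1 n \<sigma> = neg_count n \<sigma>" "l2 n \<sigma> = inv_count n \<sigma>"
    unfolding l1_def l2_def v_def[symmetric]
    using lower[OF v(1)] v(2) w len[of w] len[of v] by linarith+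
qed

section \<open>Cancellation in the symmetrized sum\<close>

text \<open>The common form of the argument for both generators; \<open>c\<close> stands for
  \<alpha> or q. Right multiplication by the involution \<open>gen_B i\<close> reindexes the
  sum.\<close>

lemma sym_B_eq_zero:
  fixes T :: "(int \<Rightarrow> 'h::real_inner \<times> 'h) \<Rightarrow> complex"
  assumes i: "i < n" and T: "\<And>y. T (y \<circ> gen_B i) = - complex_of_real c * T y" and c: "c * c = 1"
    and wt: "\<And>\<sigma>. \<sigma> \<in> type_B n \<Longrightarrow>
      \<alpha> ^ l1 n (\<sigma> \<circ> gen_B i) * q ^ l2 n (\<sigma> \<circ> gen_B i) = c * (\<alpha> ^ l1 n \<sigma> * q ^ l2 n \<sigma>)"
  shows "sym_B n \<alpha> q T = (\<lambda>_. 0)"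
proof
  fix y
  let ?f = "\<lambda>\<sigma>. complex_of_real (\<alpha> ^ l1 n \<sigma> * q ^ l2 n \<sigma>) * perm_act \<sigma> T y"
  have "sum ?f (type_B n) = (\<Sum>\<sigma>\<in>type_B n. ?f (\<sigma> \<circ> gen_B i))"
    by (rule sum.reindex_bij_witness[where i = "\<lambda>\<sigma>. \<sigma> \<circ> gen_B i" and j = "\<lambda>\<sigma>. \<sigma> \<circ> gen_B i"])
       (auto simp: comp_assoc type_B_comp gen_B_type_B i)
  also have "\<dots> = (\<Sum>\<sigma>\<in>type_B n. - ?f \<sigma>)"
  proof (rule sum.cong[OF refl])
    fix \<sigma> assume \<sigma>: "\<sigma> \<in> type_B n"
    have "perm_act (\<sigma> \<circ> gen_B i) T y = - complex_of_real c * perm_act \<sigma> T y"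
      using T[of "y \<circ> \<sigma>"] by (simp add: perm_act_def comp_assoc)
    moreover have "complex_of_real c * complex_of_real c = 1"
      using c by (metis of_real_mult of_real_1)
    \<comment> \<open>The weight contributes \<open>c\<close> and the tensor \<open>- c\<close>,
      together \<open>- (c * c) = - 1\<close>.\<close>
    ultimately show "?f (\<sigma> \<circ> gen_B i) = - ?f \<sigma>"
      unfolding wt[OF \<sigma>] by (simp add: algebra_simps)
  qed
  also have "\<dots> = - sum ?f (type_B n)" by (rule sum_negf)
  finally show "sym_B n \<alpha> q T y = 0" by (simp add: sym_B_def)
qed

text \<open>The exponents differ by one, in a direction decided by \<open>P\<close>. As
  \<open>c\<close> is its own inverse, both directions give the same factor
  \<open>c\<close>.\<close>

lemma power_of_bool_sign:
  fixes c :: real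
  assumes "c * c = 1" "a + of_bool P = b + of_bool (\<not> P)"
  shows "c ^ a = c * c ^ b"
proof (cases P)
  case True
  with assms(2) have "b = Suc a" by simp
  then show ?thesis using assms(1) by (simp flip: mult.assoc)
next
  case False
  then show ?thesis using assms(2) by simp
qed

lemma weight_gen_B_0:
  fixes \<alpha> q :: real
  assumes "\<alpha> * \<alpha> = 1" "n > 0" and \<sigma>: "\<sigma> \<in> type_B n"
  shows "\<alpha> ^ l1 n (\<sigma> \<circ> gen_B 0) * q ^ l2 n (\<sigma> \<circ> gen_B 0) = \<alpha> * (\<alpha> ^ l1 n \<sigma> * q ^ l2 n \<sigma>)"
proof -
  have \<tau>: "\<sigma> \<circ> gen_B 0 \<in> type_B n" using assms by (simp add: type_B_comp gen_B_type_B)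
  \<comment> \<open>This makes the two indicators in the count formula complementary, as
    \<open>power_of_bool_sign\<close> requires.\<close>
  have "\<sigma> 1 \<noteq> 0" using type_B_in_pm[OF \<sigma>, of 1] \<open>n > 0\<close> by (auto simp: pm_def)
  then have "neg_count n (\<sigma> \<circ> gen_B 0) + of_bool (\<sigma> 1 < 0) = neg_count n \<sigma> + of_bool (\<not> \<sigma> 1 < 0)"
    using neg_count_gen_B_0[OF \<sigma> \<open>n > 0\<close>] by (auto simp: not_less order.strict_iff_order)
  then show ?thesis
    using power_of_bool_sign[OF assms(1)] inv_count_gen_B_0[OF \<open>n > 0\<close>, of \<sigma>]
    by (simp add: l1_l2_eq_counts[OF \<sigma>] l1_l2_eq_counts[OF \<tau>])
qed

lemma weight_gen_B_pos:
  fixes \<alpha> q :: real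
  assumes "q * q = 1" and i: "0 < i" "i < n" and \<sigma>: "\<sigma> \<in> type_B n"
  shows "\<alpha> ^ l1 n (\<sigma> \<circ> gen_B i) * q ^ l2 n (\<sigma> \<circ> gen_B i) = q * (\<alpha> ^ l1 n \<sigma> * q ^ l2 n \<sigma>)"
proof -
  have \<tau>: "\<sigma> \<circ> gen_B i \<in> type_B n" using assms by (simp add: type_B_comp gen_B_type_B)
  have "\<sigma> (int i) \<noteq> \<sigma> (int i + 1)" using type_B_inj[OF \<sigma>] by simp
  then have "inv_count n (\<sigma> \<circ> gen_B i) + of_bool (\<sigma> (int i) > \<sigma> (int i + 1)) =
      inv_count n \<sigma> + of_bool (\<not> \<sigma> (int i) > \<sigma> (int i + 1))"
    using inv_count_gen_B_pos[OF \<sigma> i] by (auto simp: not_less order.strict_iff_order)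
  then show ?thesis
    using power_of_bool_sign[OF assms(1)] neg_count_gen_B_pos[OF i, of \<sigma>]
    by (simp add: l1_l2_eq_counts[OF \<sigma>] l1_l2_eq_counts[OF \<tau>])
qed

section \<open>Tensors that a generator fixes or negates\<close>

text \<open>The Hilbert-Schmidt bound carries over by \<open>\<bar>a - b\<bar>^2 \<le> 2
  \<bar>a\<bar>^2 + 2 \<bar>b\<bar>^2\<close>. This admits antisymmetrized tensors.\<close>

lemma tensor_power_diff:
  assumes "S \<in> tensor_power n" "T \<in> tensor_power n"
  shows "(\<lambda>y. S y - T y) \<in> tensor_power n"
proof -
  from assms obtain C D where
    C: "\<And>F. finite F \<Longrightarrow> corthonormal F \<Longrightarrow> (\<Sum>e\<in>PiE (pm n) (\<lambda>_. F). (cmod (S e))\<^sup>2) \<le> C" and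
    D: "\<And>F. finite F \<Longrightarrow> corthonormal F \<Longrightarrow> (\<Sum>e\<in>PiE (pm n) (\<lambda>_. F). (cmod (T e))\<^sup>2) \<le> D"
    unfolding tensor_power_def by blast
  have sq: "(cmod (a - b))\<^sup>2 \<le> 2 * (cmod a)\<^sup>2 + 2 * (cmod b)\<^sup>2" for a b
  proof -
    have "(cmod (a - b))\<^sup>2 \<le> (cmod a + cmod b)\<^sup>2"
      by (intro power_mono norm_triangle_ineq4) simp
    also have "\<dots> \<le> 2 * (cmod a)\<^sup>2 + 2 * (cmod b)\<^sup>2"
      using sum_squares_bound[of "cmod a" "cmod b"] by (simp add: power2_sum)
    finally show ?thesis .
  qed
  have "(\<Sum>e\<in>PiE (pm n) (\<lambda>_. F). (cmod (S e - T e))\<^sup>2) \<le> 2 * C + 2 * D"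
    if F: "finite F" "corthonormal F" for F
  proof -
    have "(\<Sum>e\<in>PiE (pm n) (\<lambda>_. F). (cmod (S e - T e))\<^sup>2) \<le>
        (\<Sum>e\<in>PiE (pm n) (\<lambda>_. F). 2 * (cmod (S e))\<^sup>2 + 2 * (cmod (T e))\<^sup>2)"
      by (intro sum_mono sq)
    also have "\<dots> \<le> 2 * C + 2 * D"
      using C[OF F] D[OF F] by (simp add: sum.distrib flip: sum_distrib_left)
    finally show ?thesis .
  qed
  moreover have "conj_multilinear n (\<lambda>y. S y - T y)"
  proof -
    have cm: "conj_multilinear n S" "conj_multilinear n T"
      using assms by (simp_all add: tensor_power_def)
    have "S x = S y \<and> T x = T y" if "\<forall>k\<in>pm n. x k = y k" for x y
      using cm that unfolding conj_multilinear_def by blast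
    moreover have "S (x(k := u + v)) = S (x(k := u)) + S (x(k := v))"
      "T (x(k := u + v)) = T (x(k := u)) + T (x(k := v))"
      "S (x(k := cscale c u)) = cnj c * S (x(k := u))"
      "T (x(k := cscale c u)) = cnj c * T (x(k := u))" if "k \<in> pm n" for k x u v c
      using cm that unfolding conj_multilinear_def by blast+
    ultimately show ?thesis
      unfolding conj_multilinear_def
      by (intro conjI allI ballI impI) (simp_all only: algebra_simps)
  qed
  ultimately show ?thesis unfolding tensor_power_def by blast
qed

text \<open>Serves the case \<open>c = -1\<close>: all tensor factors are equal, so permuting them
  has no effect.\<close>

lemma invariant_tensor_exists:
  fixes x :: "'h::real_inner"
  assumes "x \<noteq> 0" "i < n"
  shows "\<exists>T :: (int \<Rightarrow> 'h \<times> 'h) \<Rightarrow> complex. T \<in> tensor_power n \<and> T \<noteq> (\<lambda>_. 0) \<and>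
           (\<forall>y. T (y \<circ> gen_B i) = T y)"
proof (intro exI conjI allI)
  define T where "T = simple_tensor n (\<lambda>_. (x, 0))"
  show "T \<in> tensor_power n" by (simp add: T_def simple_tensor_in_tensor_power)
  have "T (\<lambda>_. (x, 0)) \<noteq> 0"
    using assms by (auto simp: T_def simple_tensor_def cinner_def complex_eq_iff)
  then show "T \<noteq> (\<lambda>_. 0)" by auto
  show "T (y \<circ> gen_B i) = T y" for y
    using prod.permute[OF gen_B_permutes[OF assms(2)], of "\<lambda>k. cinner (y k) (x, 0)"]
    by (simp add: T_def simple_tensor_def o_def)
qed

text \<open>Serves the case \<open>c = 1\<close>: a simple tensor minus its image under the
  involution \<open>gen_B i\<close> changes sign under it. Orthogonality keeps the difference from
  vanishing.\<close>

lemma anti_invariant_tensor_exists: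
  fixes a b :: "'h::real_inner"
  assumes "a \<noteq> 0" "b \<noteq> 0" "a \<bullet> b = 0" "i < n"
  shows "\<exists>T :: (int \<Rightarrow> 'h \<times> 'h) \<Rightarrow> complex. T \<in> tensor_power n \<and> T \<noteq> (\<lambda>_. 0) \<and>
           (\<forall>y. T (y \<circ> gen_B i) = - T y)"
proof (intro exI conjI allI)
  \<comment> \<open>The odd factor \<open>b\<close> sits at a place that \<open>gen_B i\<close>
    moves; for \<open>i = 0\<close> this is place 1.\<close>
  define x where "x = (\<lambda>k. if k = int i + 1 then (b, 0::'h) else (a, 0))"
  define S where "S = simple_tensor n x"
  define T where "T = (\<lambda>y. S y - perm_act (gen_B i) S y)"
  have S: "S \<in> tensor_power n" by (simp add: S_def simple_tensor_in_tensor_power)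
  then show "T \<in> tensor_power n"
    unfolding T_def by (intro tensor_power_diff perm_act_in_tensor_power gen_B_permutes assms)
  show "T (y \<circ> gen_B i) = - T y" for y
    by (simp add: T_def perm_act_def comp_assoc)
  have k: "int i + 1 \<in> pm n" using \<open>i < n\<close> by (auto simp: pm_def)
  have "cinner (x j) (x j) \<noteq> 0" for j
    using assms by (simp add: x_def cinner_def complex_eq_iff)
  then have "S x \<noteq> 0" by (simp add: S_def simple_tensor_def)
  \<comment> \<open>At place \<open>int i + 1\<close> the factor is the inner product of
    \<open>a\<close> and \<open>b\<close>.\<close>
  moreover have "S (x \<circ> gen_B i) = 0"
  proof -
    have "gen_B i (int i + 1) \<noteq> int i + 1"
      by (cases "i = 0") (auto simp: gen_B_0 gen_B_pos)
    then have "cinner ((x \<circ> gen_B i) (int i + 1)) (x (int i + 1)) = 0"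
      using assms by (simp add: x_def cinner_def complex_eq_iff)
    then show ?thesis using k by (auto simp: S_def simple_tensor_def)
  qed
  ultimately have "T x \<noteq> 0" by (simp add: T_def perm_act_def)
  then show "T \<noteq> (\<lambda>_. 0)" by auto
qed

text \<open>One Gram-Schmidt step: subtract from \<open>c\<close> its projection onto
  \<open>a\<close>; the remainder is nonzero by independence.\<close>

lemma orthogonal_pair_exists:
  fixes S :: "'h::real_inner set"
  assumes "independent S" "card S = 2"
  obtains a b :: 'h where "a \<noteq> 0" "b \<noteq> 0" "a \<bullet> b = 0"
proof -
  obtain a c where S: "S = {a, c}" "a \<noteq> c" using assms(2) by (auto simp: card_2_iff)
  have "a \<noteq> 0" using assms(1) S dependent_zero by blast
  have "c \<notin> span {a}"
    using assms(1) S
    by (metis dependent_def insert_iff Diff_insert_absorb insert_commute singletonD)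
  then have "c - (a \<bullet> c / (a \<bullet> a)) *\<^sub>R a \<noteq> 0"
    by (auto simp: span_singleton)
  moreover have "a \<bullet> (c - (a \<bullet> c / (a \<bullet> a)) *\<^sub>R a) = 0"
    using \<open>a \<noteq> 0\<close> by (simp add: inner_diff_right)
  ultimately show thesis using that \<open>a \<noteq> 0\<close> by blast
qed

text \<open>The last two hypotheses exclude just the degenerate cases with an injective operator:
  \<open>n = 1\<close> with \<open>\<bar>\<alpha>\<bar> < 1\<close>, the zero space, and a
  one-dimensional space with nonvanishing Poincare polynomial.\<close>

theorem theorem5p4:
  fixes n :: nat and \<alpha> q :: real
  assumes "n \<ge> 1"
    and "(\<alpha> \<in> {-1..1} \<and> q \<in> {1, -1}) \<or> (q \<in> {-1..1} \<and> \<alpha> \<in> {1, -1})"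
    and "n = 1 \<longrightarrow> \<alpha> \<in> {1, -1}"
    and "(\<exists>S::'h set. independent S \<and> card S = 2) \<or>
         (\<exists>x::'h. x \<noteq> 0) \<and> (\<alpha> = -1 \<or> q = -1 \<and> n \<ge> 2)"
  shows "\<exists>T :: (int \<Rightarrow> 'h::{real_inner,complete_space,second_countable_topology} \<times> 'h) \<Rightarrow> complex.
           T \<in> tensor_power n \<and> T \<noteq> (\<lambda>_. 0) \<and> sym_B n \<alpha> q T = (\<lambda>_. 0)"
proof -
  \<comment> \<open>Here \<open>c\<close> is the factor by which right multiplication by
    \<open>gen_B i\<close> changes the weight.\<close>
  have eigen: "\<exists>i c. i < n \<and> (i = 0 \<and> c = \<alpha> \<or> i = 1 \<and> c = q) \<and> c * c = 1 \<and>
      (\<exists>T :: (int \<Rightarrow> 'h \<times> 'h) \<Rightarrow> complex. T \<in> tensor_power n \<and> T \<noteq> (\<lambda>_. 0) \<and>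
        (\<forall>y. T (y \<circ> gen_B i) = - complex_of_real c * T y))"
  proof (cases "\<exists>S::'h set. independent S \<and> card S = 2")
    case True
    then obtain a b :: 'h where ab: "a \<noteq> 0" "b \<noteq> 0" "a \<bullet> b = 0"
      using orthogonal_pair_exists by metis
    obtain i c where ic: "i < n" "i = 0 \<and> c = \<alpha> \<or> i = 1 \<and> c = q" "c = 1 \<or> c = -1"
    proof (cases "\<alpha> \<in> {1, -1}")
      case True
      then show thesis using that[of 0 \<alpha>] assms(1) by auto
    next
      case False
      \<comment> \<open>Now \<open>q\<close> is 1 or -1, and \<open>n \<ge> 2\<close> by the
        condition on \<open>n = 1\<close>, so \<open>gen_B 1\<close> is available.\<close>
      then show thesis using that[of 1 q] assms by auto
    qed
    then show ?thesis
      using invariant_tensor_exists[OF ab(1) ic(1)] anti_invariant_tensor_exists[OF ab ic(1)]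
      by (intro exI[of _ i] exI[of _ c]) auto
  next
    case False
    \<comment> \<open>Without two independent vectors only the invariant tensor is at hand, which
      needs \<open>c = -1\<close>.\<close>
    then obtain x :: 'h where x: "x \<noteq> 0" and "\<alpha> = -1 \<or> q = -1 \<and> n \<ge> 2"
      using assms(4) by blast
    then obtain i c where ic: "i < n" "i = 0 \<and> c = \<alpha> \<or> i = 1 \<and> c = q" "c = -1"
      using assms(1) by (metis One_nat_def Suc_1 Suc_le_lessD)
    then show ?thesis
      using invariant_tensor_exists[OF x ic(1)] by (intro exI[of _ i] exI[of _ c]) auto
  qed
  then obtain i c and T :: "(int \<Rightarrow> 'h \<times> 'h) \<Rightarrow> complex" where
    i: "i < n" "i = 0 \<and> c = \<alpha> \<or> i = 1 \<and> c = q" "c * c = 1" and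
    T: "T \<in> tensor_power n" "T \<noteq> (\<lambda>_. 0)" "\<And>y. T (y \<circ> gen_B i) = - complex_of_real c * T y"
    by blast
  have "sym_B n \<alpha> q T = (\<lambda>_. 0)"
  proof (rule sym_B_eq_zero[where T = T, OF i(1) T(3) i(3)])
    fix \<sigma> assume "\<sigma> \<in> type_B n"
    then show "\<alpha> ^ l1 n (\<sigma> \<circ> gen_B i) * q ^ l2 n (\<sigma> \<circ> gen_B i) = c * (\<alpha> ^ l1 n \<sigma> * q ^ l2 n \<sigma>)"
      using i weight_gen_B_0[of \<alpha> n \<sigma> q] weight_gen_B_pos[of q i n \<sigma> \<alpha>] by auto
  qed
  then show ?thesis using T by blast
qed

end
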